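(* Let $X,Y$ be countable subsets of $[0,\infty)$ and let $S\subset X\times Y$ be a 1-erased set. If the WEP holds for $S$, then $S$ does not contain any deadlock. Conversely, if $S$ does not contain any deadlock, then there is an increasing sequence of subsets $S_n\subset S$, indexed by the integers $1\le n\le|S_X|$ (all $n\ge1$ if $S_X$ is infinite), such that: (i) $|(S_n)_X|=n$ for every $n$, and each $S_n$ is decomposed into finitely many maximal 2-nets (i.e. $S_n$ is the union of finitely many $S_n$-maximal 2-nets); (ii) the WEP holds for each $S_n$; (iii) $\bigcup_n S_n=S$.
   Context: For $T\subset X\times Y$: $T_X$ and $T_Y$ are the projections of $T$ on $X$ and $Y$, and $Y_T(x)=\{y\in Y:(x,y)\in T\}$. $T$ is 1-erased if $|Y_T(x)|\ge2$ for all $x\in T_X$. For $x\in S_X$, $M(x)=\{x\}\times Y_S(x)$. The WEP holds for $T$ if for every $f:T\to\mathbb R$ there exist $\varphi,h:T_X\to\mathbb R$ and $\psi:T_Y\to\mathbb R$ with $f(x,y)=\varphi(x)+h(x)(y-x)-\psi(y)$ for all $(x,y)\in T$. A function $\psi:T_Y\to\mathbb R$ is $T$-affine if for every $x\in T_X$ there exist real numbers $\varphi(x),h(x)$ with $\psi(y)=\varphi(x)+h(x)(y-x)$ for all $y\in Y_T(x)$. A 1-erased set $A\subset X\times Y$ is a 2-net if every $A$-affine function is affine (i.e. of the form $y\mapsto\alpha+\beta y$ on $A_Y$, with constants $\alpha,\beta\in\mathbb R$). A 2-net $A\subset T$ is $T$-maximal if for any 2-net $A'\subset T$ with $A\subset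 A'$ one has $A=A'$. A triplet $(T,x_0,y_0)$ with $T\subset S$ and $(x_0,y_0)\in S$ is a deadlock in $S$ if $|(M(x_0)\cap T)_Y|>1$ and: (i) $x_0\in T_X$, $y_0\in T_Y$, while $(x_0,y_0)\notin T$; (ii) every $T$-affine function which is null on $(M(x_0)\cap T)_Y$ is also null at $y_0$. *)

theory Defs
  imports Complex_Main "HOL-Library.Countable_Set"
begin

text \<open>
  Subsets of \<open>X \<times> Y\<close> are sets of pairs of reals; the projections \<open>T\<^sub>X\<close> and \<open>T\<^sub>Y\<close> are
  \<open>fst ` T\<close> and \<open>snd ` T\<close>.  A real function on such a set is rendered as a total function of
  which only the values on that set are ever used.
\<close>

definition fibre :: "(real \<times> real) set \<Rightarrow> real \<Rightarrow> real set" where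
  "fibre T x = {y. (x, y) \<in> T}"

text \<open>Fibres may be infinite, and \<open>card\<close> is \<open>0\<close> on infinite sets.\<close>

definition at_least_two :: "'a set \<Rightarrow> bool" where
  "at_least_two A \<longleftrightarrow> infinite A \<or> 2 \<le> card A"

definition one_erased :: "(real \<times> real) set \<Rightarrow> bool" where
  "one_erased T \<longleftrightarrow> (\<forall>x \<in> fst ` T. at_least_two (fibre T x))"

definition M :: "(real \<times> real) set \<Rightarrow> real \<Rightarrow> (real \<times> real) set" where
  "M S x = {x} \<times> fibre S x"

definition WEP :: "(real \<times> real) set \<Rightarrow> bool" where
  "WEP T \<longleftrightarrow> (\<forall>f :: real \<Rightarrow> real \<Rightarrow> real. \<exists>\<phi> h \<psi> :: real \<Rightarrow> real.
     \<forall>(x, y) \<in> T. f x y = \<phi> x + h x * (y - x) - \<psi> y)"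

definition affine_wrt :: "(real \<times> real) set \<Rightarrow> (real \<Rightarrow> real) \<Rightarrow> bool" where
  "affine_wrt T \<psi> \<longleftrightarrow>
     (\<forall>x \<in> fst ` T. \<exists>p q :: real. \<forall>y \<in> fibre T x. \<psi> y = p + q * (y - x))"

definition affine_fun_on :: "real set \<Rightarrow> (real \<Rightarrow> real) \<Rightarrow> bool" where
  "affine_fun_on B \<psi> \<longleftrightarrow> (\<exists>\<alpha> \<beta> :: real. \<forall>y \<in> B. \<psi> y = \<alpha> + \<beta> * y)"

definition two_net :: "(real \<times> real) set \<Rightarrow> bool" where
  "two_net A \<longleftrightarrow>
     one_erased A \<and> (\<forall>\<psi>. affine_wrt A \<psi> \<longrightarrow> affine_fun_on (snd ` A) \<psi>)"

definition maximal_two_net :: "(real \<times> real) set \<Rightarrow> (real \<times> real) set \<Rightarrow> bool" where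
  "maximal_two_net T A \<longleftrightarrow>
     two_net A \<and> A \<subseteq> T \<and> (\<forall>A'. two_net A' \<and> A' \<subseteq> T \<and> A \<subseteq> A' \<longrightarrow> A = A')"

definition deadlock :: "(real \<times> real) set \<Rightarrow> (real \<times> real) set \<Rightarrow> real \<Rightarrow> real \<Rightarrow> bool" where
  "deadlock S T x0 y0 \<longleftrightarrow>
     T \<subseteq> S \<and> (x0, y0) \<in> S \<and>
     at_least_two (snd ` (M S x0 \<inter> T)) \<and>
     x0 \<in> fst ` T \<and> y0 \<in> snd ` T \<and> (x0, y0) \<notin> T \<and>
     (\<forall>\<psi>. affine_wrt T \<psi> \<and> (\<forall>y \<in> snd ` (M S x0 \<inter> T). \<psi> y = 0) \<longrightarrow> \<psi> y0 = 0)"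

text \<open>The integers \<open>1 \<le> n \<le> |A|\<close>; all \<open>n \<ge> 1\<close> if \<open>A\<close> is infinite.\<close>

definition indices :: "'a set \<Rightarrow> nat set" where
  "indices A = {n. 1 \<le> n \<and> (finite A \<longrightarrow> n \<le> card A)}"

end

theory Submission
  imports Defs "HOL-Library.Function_Algebras"
begin

text \<open>
  Solving \<open>f(x, y) = \<phi>(x) + h(x)(y - x) - \<psi>(y)\<close> on \<open>T\<close> means finding a linear functional
  with prescribed values on the vectors \<open>e\<^sub>x + (y - x) e'\<^sub>x - e''\<^sub>y\<close>, \<open>(x, y) \<in> T\<close>.  So the
  WEP holds as soon as these vectors are independent, that is, as soon as \<open>T\<close> carries no nonzero
  finitely supported signed measure \<open>\<mu>\<close> with \<open>\<Sum>\<^sub>y \<mu>(x, y) = \<Sum>\<^sub>y \<mu>(x, y)(y - x) = 0\<close>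
  for all \<open>x\<close> and \<open>\<Sum>\<^sub>x \<mu>(x, y) = 0\<close> for all \<open>y\<close>.  Such a \<open>\<mu>\<close> yields a deadlock: remove
  one point \<open>(x\<^sub>0, y\<^sub>0)\<close> from its support.  Hence a set without deadlocks has the WEP, whatever
  the cardinality of its fibres, and \<open>S\<^sub>n\<close> can be the union of the first \<open>n\<close> fibres of \<open>S\<close>.
\<close>

section \<open>Linear functionals and the WEP\<close>

lemma linear_functional_extension:
  fixes v :: "'i \<Rightarrow> 'k \<Rightarrow> real" and f :: "'i \<Rightarrow> real"
  assumes indep: "\<And>U u. \<lbrakk>finite U; U \<subseteq> T; \<And>k. (\<Sum>p\<in>U. u p * v p k) = 0\<rbrakk> \<Longrightarrow> \<forall>p\<in>U. u p = 0"
  shows "\<exists>g :: ('k \<Rightarrow> real) \<Rightarrow> real. (\<forall>w w'. g (w + w') = g w + g w') \<and>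
    (\<forall>c w. g (\<lambda>k. c * w k) = c * g w) \<and> (\<forall>p\<in>T. g (v p) = f p)"
proof -
  let ?s = "\<lambda>(c::real) (w::'k \<Rightarrow> real) k. c * w k"
  interpret vector_space_pair ?s "(*) :: real \<Rightarrow> real \<Rightarrow> real"
    by unfold_locales (auto simp: fun_eq_iff algebra_simps)
  have inj: "inj_on v T"
  proof (rule inj_onI, rule ccontr)
    fix p q assume *: "p \<in> T" "q \<in> T" "v p = v q" "p \<noteq> q"
    show False
      using indep[of "{p, q}" "\<lambda>r. if r = p then 1 else -1"] * by auto
  qed
  have "vs1.independent (v ` T)"
    unfolding vs1.independent_explicit_finite_subsets
  proof (intro allI impI ballI)
    fix W u w
    assume W: "W \<subseteq> v ` T" "finite W" and sum0: "(\<Sum>w\<in>W. ?s (u w) w) = 0" and "w \<in> W"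
    then obtain U where U: "U \<subseteq> T" "finite U" "W = v ` U"
      by (meson finite_subset_image)
    have "(\<Sum>p\<in>U. u (v p) * v p k) = 0" for k
    proof -
      have "(\<Sum>w\<in>W. ?s (u w) w) k = (\<Sum>w\<in>W. u w * w k)"
        using \<open>finite W\<close> by (induction W) auto
      then show ?thesis
        using sum0 inj_on_subset[OF inj \<open>U \<subseteq> T\<close>] by (simp add: \<open>W = v ` U\<close> sum.reindex)
    qed
    then have "\<forall>p\<in>U. u (v p) = 0"
      using indep[of U "u \<circ> v"] U by simp
    then show "u w = 0"
      using \<open>w \<in> W\<close> U by auto
  qed
  then obtain g where g: "Vector_Spaces.linear ?s (*) g" "\<forall>w\<in>v ` T. g w = f (inv_into T v w)"
    using linear_independent_extend[of "v ` T" "f \<circ> inv_into T v"] by auto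
  show ?thesis
  proof (intro exI[of _ g] conjI allI ballI)
    show "g (w + w') = g w + g w'" "g (?s c w) = c * g w" for w w' c
      by (rule linear_add[OF g(1)], rule linear_scale[OF g(1)])
    show "g (v p) = f p" if "p \<in> T" for p
      using g(2) that inj by simp
  qed
qed

text \<open>The three sums are, up to sign, the coordinates of a linear combination of the vectors
  attached to the points of \<open>T\<close>, so the hypothesis says that these vectors are
  independent. A functional taking the values of \<open>f\<close> on them yields
  \<open>\<phi>\<close>, \<open>h\<close> and \<open>\<psi>\<close> as its values on the unit
  vectors.\<close>

lemma WEP_if_no_balanced_measure:
  assumes none: "\<And>U \<mu>. \<lbrakk>finite U; U \<subseteq> T;
      \<And>x. (\<Sum>p | p \<in> U \<and> fst p = x. \<mu> p) = 0;
      \<And>x. (\<Sum>p | p \<in> U \<and> fst p = x. \<mu> p * (snd p - x)) = 0;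
      \<And>y. (\<Sum>p | p \<in> U \<and> snd p = y. \<mu> p) = 0\<rbrakk> \<Longrightarrow> \<forall>p\<in>U. \<mu> p = 0"
  shows "WEP T"
  unfolding WEP_def
proof
  fix f :: "real \<Rightarrow> real \<Rightarrow> real"
  \<comment> \<open>The three summands of the index type keep apart the coordinates for
    \<open>\<phi>\<close> at x (\<open>Inl\<close>), \<open>h\<close> at x
    (\<open>Inr (Inl x)\<close>) and \<open>\<psi>\<close> at y
    (\<open>Inr (Inr y)\<close>).\<close>
  define e :: "real + real + real \<Rightarrow> real + real + real \<Rightarrow> real"
    where "e i k = (if k = i then 1 else 0)" for i k
  define v where "v p k = e (Inl (fst p)) k + (snd p - fst p) * e (Inr (Inl (fst p))) k
      + - 1 * e (Inr (Inr (snd p))) k" for p k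
  have indep: "\<forall>p\<in>U. \<mu> p = 0"
    if U: "finite U" "U \<subseteq> T" and sum0: "\<And>k. (\<Sum>p\<in>U. \<mu> p * v p k) = 0" for U and \<mu> :: "real \<times> real \<Rightarrow> real"
  proof (rule none[OF U])
    have restrict: "(\<Sum>p | p \<in> U \<and> P p. a p) = (\<Sum>p\<in>U. if P p then a p else 0)"
      for P and a :: "real \<times> real \<Rightarrow> real"
      using \<open>finite U\<close> by (rule sum.inter_filter)
    have "(\<Sum>p | p \<in> U \<and> fst p = x. \<mu> p) = (\<Sum>p\<in>U. \<mu> p * v p (Inl x))" for x
      unfolding restrict by (rule sum.cong) (auto simp: v_def e_def)
    then show "(\<Sum>p | p \<in> U \<and> fst p = x. \<mu> p) = 0" for x
      by (simp add: sum0)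
    have "(\<Sum>p | p \<in> U \<and> fst p = x. \<mu> p * (snd p - x)) = (\<Sum>p\<in>U. \<mu> p * v p (Inr (Inl x)))" for x
      unfolding restrict by (rule sum.cong) (auto simp: v_def e_def)
    then show "(\<Sum>p | p \<in> U \<and> fst p = x. \<mu> p * (snd p - x)) = 0" for x
      by (simp add: sum0)
    have "(\<Sum>p | p \<in> U \<and> snd p = y. \<mu> p) = - (\<Sum>p\<in>U. \<mu> p * v p (Inr (Inr y)))" for y
      unfolding restrict sum_negf[symmetric] by (rule sum.cong) (auto simp: v_def e_def)
    then show "(\<Sum>p | p \<in> U \<and> snd p = y. \<mu> p) = 0" for y
      by (simp add: sum0)
  qed
  obtain g where g: "\<And>w w'. g (w + w') = g w + g w'" "\<And>c w. g (\<lambda>k. c * w k) = c * g w"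
    "\<And>p. p \<in> T \<Longrightarrow> g (v p) = f (fst p) (snd p)"
    using linear_functional_extension[of T v "\<lambda>p. f (fst p) (snd p)", OF indep] by blast
  \<comment> \<open>Only sums and scalar multiples appear here, as these are the two forms that the
    laws of \<open>g\<close> can rewrite; hence the factor -1 in place of a subtraction.\<close>
  have v_eq: "v p = (e (Inl (fst p)) + (\<lambda>k. (snd p - fst p) * e (Inr (Inl (fst p))) k))
      + (\<lambda>k. - 1 * e (Inr (Inr (snd p))) k)" for p
    by (simp add: fun_eq_iff v_def)
  have "g (v p) = g (e (Inl (fst p))) + (snd p - fst p) * g (e (Inr (Inl (fst p))))
      + - 1 * g (e (Inr (Inr (snd p))))" for p
    unfolding v_eq g(1,2) ..
  then have "f x y = g (e (Inl x)) + g (e (Inr (Inl x))) * (y - x) - g (e (Inr (Inr y)))"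
    if "(x, y) \<in> T" for x y
    using g(3)[OF that] by (simp add: mult.commute)
  then show "\<exists>\<phi> h \<psi>. \<forall>(x, y)\<in>T. f x y = \<phi> x + h x * (y - x) - \<psi> y"
    by (intro exI[of _ "\<lambda>x. g (e (Inl x))"] exI[of _ "\<lambda>x. g (e (Inr (Inl x)))"]
        exI[of _ "\<lambda>y. g (e (Inr (Inr y)))"]) blast
qed

section \<open>Deadlocks in terms of fibres, and their exclusion by the WEP\<close>

lemma at_least_two_iff: "at_least_two A \<longleftrightarrow> (\<exists>a\<in>A. \<exists>b\<in>A. a \<noteq> b)"
proof (cases "finite A")
  case True
  then have "2 \<le> card A \<longleftrightarrow> \<not> card A \<le> Suc 0" by auto
  with True show ?thesis
    by (simp add: at_least_two_def card_le_Suc0_iff_eq)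
next
  case False
  then obtain a where "a \<in> A" by fastforce
  moreover obtain b where "b \<in> A - {a}"
    using False by (metis all_not_in_conv finite.emptyI infinite_remove)
  ultimately show ?thesis
    using False by (auto simp: at_least_two_def)
qed

lemma at_least_two_mono: "at_least_two A \<Longrightarrow> A \<subseteq> B \<Longrightarrow> at_least_two B"
  unfolding at_least_two_iff by blast

lemma snd_M_Int: "T \<subseteq> S \<Longrightarrow> snd ` (M S x \<inter> T) = fibre T x"
  by (force simp: M_def fibre_def)

lemma deadlock_iff:
  "deadlock S T x0 y0 \<longleftrightarrow> T \<subseteq> S \<and> (x0, y0) \<in> S - T \<and>
     at_least_two (fibre T x0) \<and> x0 \<in> fst ` T \<and> y0 \<in> snd ` T \<and>
     (\<forall>\<psi>. affine_wrt T \<psi> \<and> (\<forall>y\<in>fibre T x0. \<psi> y = 0) \<longrightarrow> \<psi> y0 = 0)"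
proof (cases "T \<subseteq> S")
  case True
  show ?thesis
    unfolding deadlock_def snd_M_Int[OF True] by blast
next
  case False
  then show ?thesis
    by (simp add: deadlock_def)
qed

text \<open>Used contrapositively: every subset of a deadlock-free set is deadlock-free.\<close>

lemma deadlock_mono: "deadlock S T x y \<Longrightarrow> S \<subseteq> S' \<Longrightarrow> deadlock S' T x y"
  unfolding deadlock_iff by blast

text \<open>Apply the WEP to the indicator of (x0, y0). On \<open>T\<close> the indicator vanishes,
  so the resulting \<open>\<psi>\<close> is \<open>T\<close>-affine; subtracting its affine
  expression at x0 makes it null on the fibre over x0, yet its value at y0 becomes -1.\<close>

lemma not_deadlock_if_WEP:
  assumes "WEP S"
  shows "\<not> deadlock S T x0 y0"
proof
  assume dl: "deadlock S T x0 y0"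
  then have "T \<subseteq> S" "(x0, y0) \<in> S" "x0 \<in> fst ` T" "(x0, y0) \<notin> T"
    and null: "\<And>\<psi>. affine_wrt T \<psi> \<Longrightarrow> \<forall>y\<in>fibre T x0. \<psi> y = 0 \<Longrightarrow> \<psi> y0 = 0"
    unfolding deadlock_iff by blast+
  define f :: "real \<Rightarrow> real \<Rightarrow> real" where "f x y = (if x = x0 \<and> y = y0 then 1 else 0)" for x y
  obtain \<phi> h \<psi> :: "real \<Rightarrow> real"
    where eq: "\<And>x y. (x, y) \<in> S \<Longrightarrow> f x y = \<phi> x + h x * (y - x) - \<psi> y"
    using \<open>WEP S\<close> unfolding WEP_def by blast
  define \<psi>' where "\<psi>' y = \<psi> y - (\<phi> x0 + h x0 * (y - x0))" for y
  have \<psi>: "\<psi> y = \<phi> x + h x * (y - x)" if "(x, y) \<in> T" for x y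
    using eq[of x y] that \<open>T \<subseteq> S\<close> \<open>(x0, y0) \<notin> T\<close> by (auto simp: f_def split: if_splits)
  have "affine_wrt T \<psi>'"
    unfolding affine_wrt_def
  proof
    fix x
    have "\<psi>' y = (\<phi> x - \<phi> x0 - h x0 * (x - x0)) + (h x - h x0) * (y - x)" if "y \<in> fibre T x" for y
      using \<psi>[of x y] that by (simp add: \<psi>'_def fibre_def algebra_simps)
    then show "\<exists>p q. \<forall>y\<in>fibre T x. \<psi>' y = p + q * (y - x)" by blast
  qed
  moreover have "\<forall>y\<in>fibre T x0. \<psi>' y = 0"
    using \<psi> by (simp add: \<psi>'_def fibre_def)
  ultimately have "\<psi>' y0 = 0" by (rule null)
  then show False
    using eq[OF \<open>(x0, y0) \<in> S\<close>] by (simp add: f_def \<psi>'_def)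
qed

section \<open>From balanced measures to deadlocks\<close>

text \<open>Integrate a \<open>T\<close>-affine \<open>\<psi>\<close> that is null on the remaining
  fibre over x0 against \<open>\<mu>\<close>. Grouped by y the integral is 0; grouped by x only the
  removed point contributes. As its mass is nonzero, \<open>\<psi>\<close> vanishes at y0.\<close>

lemma deadlock_if_balanced_measure:
  fixes \<mu> :: "real \<times> real \<Rightarrow> real"
  assumes "finite U" "U \<subseteq> S"
    and sum_x: "\<And>x. (\<Sum>p | p \<in> U \<and> fst p = x. \<mu> p) = 0"
    and moment_x: "\<And>x. (\<Sum>p | p \<in> U \<and> fst p = x. \<mu> p * (snd p - x)) = 0"
    and sum_y: "\<And>y. (\<Sum>p | p \<in> U \<and> snd p = y. \<mu> p) = 0"
    and nonzero: "\<And>p. p \<in> U \<Longrightarrow> \<mu> p \<noteq> 0"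
    and "(x0, y0) \<in> U"
  shows "deadlock S (U - {(x0, y0)}) x0 y0"
proof -
  let ?p0 = "(x0, y0)"
  define T where "T = U - {?p0}"
  define Ux where "Ux = {p \<in> U. fst p = x0} - {?p0}"
  have "finite {p \<in> U. fst p = x0}" "?p0 \<in> {p \<in> U. fst p = x0}"
    using assms by auto
  note remove = sum.remove[OF this, folded Ux_def]
  have Ux_sum: "(\<Sum>p\<in>Ux. \<mu> p) = - \<mu> ?p0"
    using sum_x[of x0] by (simp add: remove)
  have "(\<Sum>p\<in>Ux. \<mu> p * (snd p - x0)) = - \<mu> ?p0 * (y0 - x0)"
    using moment_x[of x0] by (simp add: remove)
  moreover have "\<mu> ?p0 \<noteq> 0"
    using assms by blast
  moreover have "snd p \<noteq> y0" if "p \<in> Ux" for p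
    using that by (cases p) (auto simp: Ux_def)
  \<comment> \<open>If \<open>Ux\<close> were empty, the removed point would have mass 0. If it were
    a single point, mass and moment together would force its second coordinate to be y0.\<close>
  ultimately have "\<nexists>p. Ux = {p}" "Ux \<noteq> {}"
    using Ux_sum by auto
  then obtain p q where "p \<in> Ux" "q \<in> Ux" "p \<noteq> q"
    by blast
  then have two: "at_least_two (fibre T x0)"
    unfolding at_least_two_iff
    by (cases p; cases q) (auto simp: Ux_def T_def fibre_def intro!: bexI[of _ "snd p"] bexI[of _ "snd q"])
  then have "x0 \<in> fst ` T"
    unfolding at_least_two_iff by (force simp: fibre_def)
  \<comment> \<open>The total mass at height y0 is 0, so some other point must balance the removed
    one.\<close>
  have "{p \<in> U. snd p = y0} \<noteq> {?p0}"
    using sum_y[of y0] \<open>\<mu> ?p0 \<noteq> 0\<close> by auto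
  then have "y0 \<in> snd ` T"
    using \<open>?p0 \<in> U\<close> by (force simp: T_def)
  have "\<psi> y0 = 0" if aff: "affine_wrt T \<psi>" and null: "\<forall>y\<in>fibre T x0. \<psi> y = 0" for \<psi>
  proof -
    have group: "(\<Sum>p\<in>U. a p) = (\<Sum>z\<in>\<pi> ` U. \<Sum>p | p \<in> U \<and> \<pi> p = z. a p)"
      for \<pi> :: "real \<times> real \<Rightarrow> real" and a :: "real \<times> real \<Rightarrow> real"
      using \<open>finite U\<close> by (rule sum.image_gen)
    have "(\<Sum>p | p \<in> U \<and> snd p = y. \<mu> p * \<psi> (snd p)) = (\<Sum>p | p \<in> U \<and> snd p = y. \<mu> p) * \<psi> y" for y
      unfolding sum_distrib_right by (rule sum.cong) auto
    then have "(\<Sum>p\<in>U. \<mu> p * \<psi> (snd p)) = 0"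
      unfolding group[of _ snd] by (simp add: sum_y)
    moreover
    have "(\<Sum>p | p \<in> U \<and> fst p = x. \<mu> p * \<psi> (snd p)) = (if x = x0 then \<mu> ?p0 * \<psi> y0 else 0)"
      if "x \<in> fst ` U" for x
    proof (cases "x = x0")
      case True
      have "(\<Sum>p\<in>Ux. \<mu> p * \<psi> (snd p)) = 0"
        using null by (intro sum.neutral) (auto simp: Ux_def T_def fibre_def)
      with True show ?thesis by (simp add: remove)
    next
      case False
      then have "x \<in> fst ` T" using that by (force simp: T_def)
      then obtain a b where ab: "\<forall>y\<in>fibre T x. \<psi> y = a + b * (y - x)"
        using aff unfolding affine_wrt_def by blast
      have "(\<Sum>p | p \<in> U \<and> fst p = x. \<mu> p * \<psi> (snd p))
          = (\<Sum>p | p \<in> U \<and> fst p = x. a * \<mu> p + b * (\<mu> p * (snd p - x)))"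
        \<comment> \<open>For x other than x0 the fibres of \<open>U\<close> and \<open>T\<close>
          coincide, so the affine form of \<open>\<psi>\<close> holds on the whole group.\<close>
        using ab False by (intro sum.cong) (auto simp: T_def fibre_def distrib_left mult_ac)
      also have "\<dots> = 0"
        unfolding sum.distrib sum_distrib_left[symmetric] by (simp add: sum_x moment_x)
      finally show ?thesis using False by simp
    qed
    then have "(\<Sum>p\<in>U. \<mu> p * \<psi> (snd p)) = \<mu> ?p0 * \<psi> y0"
      unfolding group[of _ fst]
      using assms(1) image_eqI[of x0 fst ?p0 U] \<open>?p0 \<in> U\<close> by simp
    ultimately show ?thesis
      using \<open>\<mu> ?p0 \<noteq> 0\<close> by simp
  qed
  moreover have "T \<subseteq> S" "?p0 \<notin> T" "?p0 \<in> S"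
    using assms by (auto simp: T_def)
  ultimately have "deadlock S T x0 y0"
    using two \<open>x0 \<in> fst ` T\<close> \<open>y0 \<in> snd ` T\<close> unfolding deadlock_iff by blast
  then show ?thesis by (simp add: T_def)
qed

lemma WEP_if_no_deadlock:
  assumes "\<not> (\<exists>T x0 y0. deadlock S T x0 y0)"
  shows "WEP S"
proof (rule WEP_if_no_balanced_measure, rule ccontr)
  fix U and \<mu> :: "real \<times> real \<Rightarrow> real"
  assume "finite U" "U \<subseteq> S"
    and sums: "\<And>x. (\<Sum>p | p \<in> U \<and> fst p = x. \<mu> p) = 0"
      "\<And>x. (\<Sum>p | p \<in> U \<and> fst p = x. \<mu> p * (snd p - x)) = 0"
      "\<And>y. (\<Sum>p | p \<in> U \<and> snd p = y. \<mu> p) = 0"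
    and "\<not> (\<forall>p\<in>U. \<mu> p = 0)"
  \<comment> \<open>Restricting to the support makes every mass nonzero; the balance sums do not
    change, since their terms vanish with \<open>\<mu>\<close>.\<close>
  define V where "V = {p \<in> U. \<mu> p \<noteq> 0}"
  have V_sum: "(\<Sum>p | p \<in> V \<and> P p. a p) = (\<Sum>p | p \<in> U \<and> P p. a p)"
    if "\<And>p. \<mu> p = 0 \<Longrightarrow> a p = 0" for P and a :: "real \<times> real \<Rightarrow> real"
    using \<open>finite U\<close> that by (intro sum.mono_neutral_left) (auto simp: V_def)
  obtain x0 y0 where "(x0, y0) \<in> V"
    using \<open>\<not> (\<forall>p\<in>U. \<mu> p = 0)\<close> by (auto simp: V_def)
  then have "deadlock S (V - {(x0, y0)}) x0 y0"
    using \<open>finite U\<close> \<open>U \<subseteq> S\<close>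
    by (intro deadlock_if_balanced_measure[where \<mu> = \<mu>]) (auto simp: V_sum sums, auto simp: V_def)
  then show False using assms by blast
qed

section \<open>Existence of maximal 2-nets\<close>

lemma affine_eqI:
  fixes a b a' b' :: real
  assumes "y1 \<noteq> y2" "a + b * y1 = a' + b' * y1" "a + b * y2 = a' + b' * y2"
  shows "a = a'" "b = b'"
proof -
  have "(b - b') * (y1 - y2) = 0" using assms by (simp add: algebra_simps)
  then show "b = b'" using assms(1) by simp
  then show "a = a'" using assms(2) by simp
qed

text \<open>A function affine with respect to the union is affine on the projection of each member.
  Of two nonempty members one contains the other, so they share two distinct ordinates and their
  coefficients agree.\<close>

lemma two_net_Union_chain:
  assumes nets: "\<And>A. A \<in> C \<Longrightarrow> two_net A" and chain: "\<And>A B. A \<in> C \<Longrightarrow> B \<in> C \<Longrightarrow> A \<subseteq> B \<or> B \<subseteq> A"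
  shows "two_net (\<Union>C)"
  unfolding two_net_def
proof (intro conjI allI impI)
  show "one_erased (\<Union>C)"
    unfolding one_erased_def
  proof
    fix x assume "x \<in> fst ` \<Union>C"
    then obtain A where "A \<in> C" "x \<in> fst ` A" by blast
    moreover have "fibre A x \<subseteq> fibre (\<Union>C) x"
      using \<open>A \<in> C\<close> by (auto simp: fibre_def)
    ultimately show "at_least_two (fibre (\<Union>C) x)"
      using nets[of A] at_least_two_mono by (auto simp: two_net_def one_erased_def)
  qed
  fix \<psi> assume \<psi>: "affine_wrt (\<Union>C) \<psi>"
  have "affine_wrt A \<psi>" if "A \<in> C" for A
    unfolding affine_wrt_def
  proof
    fix x assume "x \<in> fst ` A"
    then have "x \<in> fst ` \<Union>C" using that by blast
    then obtain p q where "\<forall>y\<in>fibre (\<Union>C) x. \<psi> y = p + q * (y - x)"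
      using \<psi> unfolding affine_wrt_def by blast
    moreover have "fibre A x \<subseteq> fibre (\<Union>C) x"
      using that by (auto simp: fibre_def)
    ultimately show "\<exists>p q. \<forall>y\<in>fibre A x. \<psi> y = p + q * (y - x)" by blast
  qed
  then have aff: "\<exists>a b. \<forall>y\<in>snd ` A. \<psi> y = a + b * y" if "A \<in> C" for A
    using nets that unfolding two_net_def affine_fun_on_def by blast
  show "affine_fun_on (snd ` \<Union>C) \<psi>"
  proof (cases "\<Union>C = {}")
    case True
    then show ?thesis by (simp only: affine_fun_on_def) simp
  next
    case False
    \<comment> \<open>A fixed nonempty member supplies the coefficients; two of its ordinates
      suffice to compare them with those of any larger member.\<close>
    then obtain A0 x where A0: "A0 \<in> C" "x \<in> fst ` A0" by fastforce
    then have "at_least_two (fibre A0 x)"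
      using nets by (auto simp: two_net_def one_erased_def)
    then obtain y1 y2 where y: "y1 \<in> snd ` A0" "y2 \<in> snd ` A0" "y1 \<noteq> y2"
      unfolding at_least_two_iff by (force simp: fibre_def)
    obtain a b where ab: "\<forall>y\<in>snd ` A0. \<psi> y = a + b * y"
      using aff[OF A0(1)] by blast
    have "\<psi> y = a + b * y" if "A \<in> C" "y \<in> snd ` A" for A y
    proof (cases "A \<subseteq> A0")
      case True
      then show ?thesis using ab that by blast
    next
      case False
      then have "A0 \<subseteq> A" using chain A0 that by blast
      obtain a' b' where ab': "\<forall>y\<in>snd ` A. \<psi> y = a' + b' * y"
        using aff \<open>A \<in> C\<close> by blast
      moreover have "y1 \<in> snd ` A" "y2 \<in> snd ` A"
        using y \<open>A0 \<subseteq> A\<close> by blast+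
      ultimately have "a + b * y1 = a' + b' * y1" "a + b * y2 = a' + b' * y2"
        using ab y by metis+
      then have "a = a'" "b = b'"
        by (rule affine_eqI[OF y(3)])+
      then show ?thesis using ab' that by blast
    qed
    then show ?thesis unfolding affine_fun_on_def by blast
  qed
qed

text \<open>Zorn's lemma on the 2-nets between \<open>A\<close> and \<open>T\<close>, with unions of
  chains as upper bounds.\<close>

lemma two_net_subset_maximal:
  assumes "two_net A" "A \<subseteq> T"
  obtains B where "maximal_two_net T B" "A \<subseteq> B"
proof -
  let ?\<A> = "{B. two_net B \<and> A \<subseteq> B \<and> B \<subseteq> T}"
  have "\<Union>C \<in> ?\<A>" if "C \<noteq> {}" "subset.chain ?\<A> C" for C
    using that two_net_Union_chain[of C] unfolding subset_chain_def by blast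
  then obtain B where "B \<in> ?\<A>" "\<forall>B'\<in>?\<A>. B \<subseteq> B' \<longrightarrow> B' = B"
    using subset_Zorn_nonempty[of ?\<A>] assms by blast
  then show thesis
    by (intro that[of B]) (unfold maximal_two_net_def, blast+)
qed

text \<open>With a single fibre, being affine with respect to the set already means being affine on
  its projection. These nets are the seeds from which maximal ones are grown.\<close>

lemma two_net_M:
  assumes "one_erased T" "x \<in> fst ` T"
  shows "two_net (M T x)"
proof -
  have fibre: "fibre (M T x) x' = (if x' = x then fibre T x else {})" for x'
    by (auto simp: fibre_def M_def)
  have "affine_fun_on (snd ` M T x) \<psi>" if \<psi>: "affine_wrt (M T x) \<psi>" for \<psi>
  proof -
    have "at_least_two (fibre T x)"
      using assms unfolding one_erased_def by blast
    then have "x \<in> fst ` M T x"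
      by (auto simp: M_def at_least_two_iff)
    then obtain p q where "\<forall>y\<in>fibre T x. \<psi> y = p + q * (y - x)"
      using \<psi> unfolding affine_wrt_def by (metis fibre)
    then have "\<forall>y\<in>snd ` M T x. \<psi> y = (p - q * x) + q * y"
      by (auto simp: M_def algebra_simps)
    then show ?thesis unfolding affine_fun_on_def by blast
  qed
  moreover have "one_erased (M T x)"
    using assms by (auto simp: one_erased_def fibre) (auto simp: M_def)
  ultimately show ?thesis by (simp add: two_net_def)
qed

text \<open>Choose a maximal 2-net around each fibre; there are only finitely many fibres, though
  each may be infinite.\<close>

lemma finite_maximal_two_net_cover:
  assumes "one_erased T" "finite (fst ` T)"
  shows "\<exists>F. finite F \<and> (\<forall>A\<in>F. maximal_two_net T A) \<and> T = \<Union>F"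
proof -
  have "\<exists>B. maximal_two_net T B \<and> M T x \<subseteq> B" if "x \<in> fst ` T" for x
    using two_net_subset_maximal[OF two_net_M[OF assms(1) that], of T]
    by (auto simp: M_def fibre_def)
  then obtain B where B: "\<And>x. x \<in> fst ` T \<Longrightarrow> maximal_two_net T (B x) \<and> M T x \<subseteq> B x"
    by metis
  have "T = \<Union>(B ` fst ` T)"
  proof
    show "T \<subseteq> \<Union>(B ` fst ` T)"
      using B by (fastforce simp: M_def fibre_def)
    show "\<Union>(B ` fst ` T) \<subseteq> T"
      using B unfolding maximal_two_net_def by blast
  qed
  then show ?thesis
    using assms(2) B by (intro exI[of _ "B ` fst ` T"]) auto
qed

section \<open>Enumeration of the abscissae and the exhausting sequence\<close>

text \<open>The enumeration \<open>to_nat_on A\<close> maps onto an initial segment of the naturals,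
  or onto all of them; the bound in \<open>indices\<close> ensures that every number below
  \<open>n\<close> is attained.\<close>

lemma bij_betw_to_nat_on_less:
  assumes "countable A" "n \<in> indices A"
  shows "bij_betw (to_nat_on A) {a \<in> A. to_nat_on A a < n} {..<n}"
proof -
  have "{..<n} \<subseteq> to_nat_on A ` A"
  proof (cases "finite A")
    case True
    then show ?thesis
      using assms(2) bij_betw_imp_surj_on[OF to_nat_on_finite[OF True]] by (auto simp: indices_def)
  next
    case False
    then show ?thesis
      using assms(1) image_to_nat_on by blast
  qed
  then have "to_nat_on A ` {a \<in> A. to_nat_on A a < n} = {..<n}"
    by blast
  moreover have "inj_on (to_nat_on A) {a \<in> A. to_nat_on A a < n}"
    by (rule inj_on_subset[OF inj_on_to_nat_on[OF assms(1)]]) blast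
  ultimately show ?thesis
    by (simp add: bij_betw_def)
qed

text \<open>The enumeration starts at 0 and the indices at 1, so an element numbered k first enters
  at stage k + 1.\<close>

lemma Suc_to_nat_on_in_indices:
  assumes "a \<in> A"
  shows "Suc (to_nat_on A a) \<in> indices A"
  using assms bij_betw_apply[OF to_nat_on_finite, of A a] by (auto simp: indices_def)

theorem theorem6p21:
  fixes X Y :: "real set" and S :: "(real \<times> real) set"
  assumes "countable X" and "X \<subseteq> {0..}"
    and "countable Y" and "Y \<subseteq> {0..}"
    and "S \<subseteq> X \<times> Y"
    and "one_erased S"
  shows "(WEP S \<longrightarrow> \<not> (\<exists>T x0 y0. deadlock S T x0 y0)) \<and>
    (\<not> (\<exists>T x0 y0. deadlock S T x0 y0) \<longrightarrow>
      (\<exists>Sn :: nat \<Rightarrow> (real \<times> real) set.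
        (\<forall>n \<in> indices (fst ` S). Sn n \<subseteq> S) \<and>
        mono_on (indices (fst ` S)) Sn \<and>
        (\<forall>n \<in> indices (fst ` S).
          finite (fst ` Sn n) \<and> card (fst ` Sn n) = n \<and>
          (\<exists>F. finite F \<and> (\<forall>A \<in> F. maximal_two_net (Sn n) A) \<and> Sn n = \<Union>F)) \<and>
        (\<forall>n \<in> indices (fst ` S). WEP (Sn n)) \<and>
        (\<Union>n \<in> indices (fst ` S). Sn n) = S))"
proof (intro conjI impI)
  assume "WEP S"
  then show "\<not> (\<exists>T x0 y0. deadlock S T x0 y0)"
    using not_deadlock_if_WEP by blast
next
  assume no_deadlock: "\<not> (\<exists>T x0 y0. deadlock S T x0 y0)"
  let ?I = "indices (fst ` S)"
  let ?r = "to_nat_on (fst ` S)"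
  define Sn where "Sn n = {p \<in> S. ?r (fst p) < n}" for n
  have "countable (fst ` S)"
    by (rule countable_subset[OF _ assms(1)]) (use assms(5) in auto)
  note bij = bij_betw_to_nat_on_less[OF this]
  have sub: "Sn n \<subseteq> S" for n
    by (auto simp: Sn_def)
  have fst_Sn: "fst ` Sn n = {x \<in> fst ` S. ?r x < n}" for n
    by (force simp: Sn_def)
  have fin: "finite (fst ` Sn n)" if "n \<in> ?I" for n
    using bij_betw_finite[OF bij[OF that]] by (simp add: fst_Sn)
  have card: "card (fst ` Sn n) = n" if "n \<in> ?I" for n
    using bij_betw_same_card[OF bij[OF that]] by (simp add: fst_Sn)
  \<comment> \<open>Fibres are kept whole, so \<open>Sn n\<close> inherits being 1-erased from
    \<open>S\<close>.\<close>
  have fibre: "fibre (Sn n) x = fibre S x" if "x \<in> fst ` Sn n" for n x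
    using that by (auto simp: fibre_def Sn_def)
  then have "one_erased (Sn n)" for n
    using assms(6) unfolding one_erased_def fst_Sn by auto
  then have cover: "\<exists>F. finite F \<and> (\<forall>A\<in>F. maximal_two_net (Sn n) A) \<and> Sn n = \<Union>F" if "n \<in> ?I" for n
    using finite_maximal_two_net_cover fin that by blast
  have WEP: "WEP (Sn n)" for n
    using no_deadlock deadlock_mono[OF _ sub] by (intro WEP_if_no_deadlock) blast
  have union: "(\<Union>n\<in>?I. Sn n) = S"
  proof
    show "S \<subseteq> (\<Union>n\<in>?I. Sn n)"
    proof
      fix p assume "p \<in> S"
      then have "Suc (?r (fst p)) \<in> ?I" "p \<in> Sn (Suc (?r (fst p)))"
        by (auto simp: Suc_to_nat_on_in_indices Sn_def)
      then show "p \<in> (\<Union>n\<in>?I. Sn n)" by blast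
    qed
  qed (use sub in blast)
  have mono: "mono_on ?I Sn"
    by (auto simp: mono_on_def Sn_def)
  show "\<exists>Sn :: nat \<Rightarrow> (real \<times> real) set.
        (\<forall>n \<in> ?I. Sn n \<subseteq> S) \<and> mono_on ?I Sn \<and>
        (\<forall>n \<in> ?I. finite (fst ` Sn n) \<and> card (fst ` Sn n) = n \<and>
          (\<exists>F. finite F \<and> (\<forall>A \<in> F. maximal_two_net (Sn n) A) \<and> Sn n = \<Union>F)) \<and>
        (\<forall>n \<in> ?I. WEP (Sn n)) \<and> (\<Union>n \<in> ?I. Sn n) = S"
    by (intro exI[of _ Sn] conjI ballI sub mono fin card cover WEP union)
qed

end
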